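(* Let $(X,\|\cdot\|)$ be a real normed space with open unit ball $B$, let $K\subset X$ be a convex body, and fix $x_0\in\partial K$. Then $x_0$ is not a flattening point of $\partial K$ if and only if $$ \mathrm{int}\bigl((\partial K\cap(x_0+\varepsilon B))+(\partial K\cap(x_0+\varepsilon B))\bigr)\neq\emptyset\qquad\text{for arbitrarily small }\varepsilon>0. $$
   Context: $B=\{x\in X:\|x\|<1\}$ is the open unit ball of $X$; $X^*$ is the (continuous) dual of $X$ and $S^*$ is the unit sphere of $X^*$ in the dual norm. For sets $P,Q\subset X$, $P+Q=\{p+q:p\in P,\ q\in Q\}$, $x_0+\varepsilon B=\{x_0+\varepsilon b:b\in B\}$, and $\mathrm{int}$, $\partial$ denote interior and boundary in $X$. A convex body is a closed convex subset of $X$ with nonempty interior (not assumed bounded). For a convex body $A\subset X$ and $x_0\in\partial A$, let $\partial A(x_0)$ be the set of all $x_0^*\in S^*$ such that $x_0^*(x)\le x_0^*(x_0)$ for every $x\in A$. The point $x_0\in\partial A$ is a flattening point of $\partial A$ if there exist $\varepsilon>0$, $x_0^*\in\partial A(x_0)$ and $c\in\mathbb{R}$ such that $x_0^*(x)=c$ for all $x\in\partial A\cap(x_0+\varepsilon B)$. Since the sets in the displayed condition increase with $\varepsilon$, "for arbitrarily small $\varepsilon>0$" is equivalent to "for every $\varepsilon>0$". *)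

theory Defs
  imports "HOL-Analysis.Analysis" "HOL-Library.Set_Algebras"
begin

definition convex_body :: "'a::real_normed_vector set \<Rightarrow> bool" where
  "convex_body A \<longleftrightarrow> closed A \<and> convex A \<and> interior A \<noteq> {}"

text \<open>The dual space is the type of bounded linear maps into the reals, whose norm is the
  operator norm; \<open>sphere 0 1\<close> in it is thus the unit sphere of the dual. The type also
  makes sense for incomplete and for infinite-dimensional spaces.\<close>

definition unit_support_functionals ::
    "'a::real_normed_vector set \<Rightarrow> 'a \<Rightarrow> ('a \<Rightarrow>\<^sub>L real) set" where
  "unit_support_functionals A x\<^sub>0 =
     {f \<in> sphere 0 1. \<forall>x\<in>A. blinfun_apply f x \<le> blinfun_apply f x\<^sub>0}"

definition flattening_point :: "'a::real_normed_vector set \<Rightarrow> 'a \<Rightarrow> bool" where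
  "flattening_point A x\<^sub>0 \<longleftrightarrow>
     x\<^sub>0 \<in> frontier A \<and>
     (\<exists>\<epsilon>>0. \<exists>f\<in>unit_support_functionals A x\<^sub>0. \<exists>c::real.
        \<forall>x \<in> frontier A \<inter> ball x\<^sub>0 \<epsilon>. blinfun_apply f x = c)"

end

theory Submission
  imports Defs
begin

text \<open>If \<open>2x\<^sub>0 - r \<in> K\<close> for all boundary points \<open>r\<close> near \<open>x\<^sub>0\<close>, then the boundary near \<open>x\<^sub>0\<close> is
  symmetric about \<open>x\<^sub>0\<close> and midpoint convex, hence spans a hyperplane that supports \<open>K\<close>, and \<open>x\<^sub>0\<close> is
  a flattening point; this needs no Hahn-Banach theorem. Otherwise there is a boundary point \<open>r\<close> near
  \<open>x\<^sub>0\<close> with \<open>2x\<^sub>0 - r \<notin> K\<close>. For every \<open>y\<close> in some nonempty open set close to \<open>2x\<^sub>0\<close>, the point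
  \<open>y - x\<^sub>0\<close> is interior to \<open>K\<close> whereas \<open>y - r \<notin> K\<close>. As \<open>p\<close> moves from \<open>x\<^sub>0\<close> to \<open>r\<close> in a small connected
  part of the boundary, \<open>y - p\<close> must cross the boundary, which exhibits \<open>y\<close> as a sum of two boundary
  points near \<open>x\<^sub>0\<close>. The connected parts come from radial projection along the Minkowski functional.\<close>

section \<open>The Minkowski functional of a convex set around the origin\<close>

definition minkowski_functional :: "'a::real_normed_vector set \<Rightarrow> 'a \<Rightarrow> real" where
  "minkowski_functional C v = Inf {t. 0 < t \<and> v /\<^sub>R t \<in> C}"

text \<open>Shrinking \<open>interior C\<close> towards \<open>b\<close> by the factor
  \<open>t\<close> gives an open set, which convexity keeps inside \<open>C\<close>;
  \<open>t > 0\<close> is what makes it open.\<close>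

lemma interior_scaleR_convex:
  fixes C :: "'a::real_normed_vector set"
  assumes "convex C" "a \<in> interior C" "b \<in> C" "0 < t" "t \<le> 1"
  shows "t *\<^sub>R a + (1 - t) *\<^sub>R b \<in> interior C"
proof -
  define U where "U = (\<lambda>y. (1 - t) *\<^sub>R b + y) ` (\<lambda>y. t *\<^sub>R y) ` interior C"
  have "open U"
    unfolding U_def using assms by (intro open_translation open_scaling) auto
  moreover have "U \<subseteq> C"
  proof
    fix z assume "z \<in> U"
    then obtain y where y: "y \<in> interior C" "z = (1 - t) *\<^sub>R b + t *\<^sub>R y"
      by (auto simp: U_def)
    then show "z \<in> C"
      using assms interior_subset[of C] by (auto intro!: convexD[OF \<open>convex C\<close>])
  qed
  moreover have "t *\<^sub>R a + (1 - t) *\<^sub>R b \<in> U"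
    using assms unfolding U_def image_image by (auto simp: add.commute)
  ultimately show ?thesis
    using interior_maximal by blast
qed

context
  fixes C :: "'a::real_normed_vector set" and \<rho> :: real
  assumes convex: "convex C" and pos: "0 < \<rho>" and ball: "ball 0 \<rho> \<subseteq> C"
begin

lemma minkowski_functional_bdd_below: "bdd_below {t. 0 < t \<and> v /\<^sub>R t \<in> C}"
  by (rule bdd_belowI[of _ 0]) auto

lemma zero_in_interior: "0 \<in> interior C"
  using ball pos by (meson centre_in_ball interior_maximal open_ball subsetD)

lemma divideR_in_convex_mono:
  assumes "v /\<^sub>R s \<in> C" "0 < s" "s \<le> t"
  shows "v /\<^sub>R t \<in> C"
proof -
  have "(s / t) *\<^sub>R (v /\<^sub>R s) + (1 - s / t) *\<^sub>R 0 \<in> C"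
    using assms zero_in_interior interior_subset
    by (intro convexD[OF convex]) (auto simp: field_simps)
  then show ?thesis using assms by (simp add: field_simps)
qed

lemma divideR_in_of_norm_less:
  assumes "norm v / \<rho> < t"
  shows "0 < t" "v /\<^sub>R t \<in> C"
proof -
  show t: "0 < t" using assms pos by (smt (verit) divide_nonneg_pos norm_ge_zero)
  have "v /\<^sub>R t \<in> ball 0 \<rho>" using assms t pos by (simp add: field_simps)
  then show "v /\<^sub>R t \<in> C" using ball by blast
qed

lemma minkowski_functional_set_nonempty: "{t. 0 < t \<and> v /\<^sub>R t \<in> C} \<noteq> {}"
  using divideR_in_of_norm_less[of v "norm v / \<rho> + 1"] by force

lemma minkowski_functional_le: "0 < t \<Longrightarrow> v /\<^sub>R t \<in> C \<Longrightarrow> minkowski_functional C v \<le> t"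
  unfolding minkowski_functional_def
  by (rule cInf_lower[OF _ minkowski_functional_bdd_below]) simp

lemma minkowski_functional_nonneg: "0 \<le> minkowski_functional C v"
  unfolding minkowski_functional_def
  by (rule cInf_greatest[OF minkowski_functional_set_nonempty]) simp

lemma divideR_in_of_minkowski_functional_less:
  assumes "minkowski_functional C v < t"
  shows "v /\<^sub>R t \<in> C"
proof -
  obtain s where "0 < s" "v /\<^sub>R s \<in> C" "s < t"
    using assms cInf_lessD[OF minkowski_functional_set_nonempty]
    unfolding minkowski_functional_def by force
  then show ?thesis using divideR_in_convex_mono by simp
qed

lemma minkowski_functional_add_le:
  "minkowski_functional C (v + w) \<le> minkowski_functional C v + minkowski_functional C w"
proof (rule field_le_epsilon)
  fix e :: real assume e: "0 < e"
  \<comment> \<open>The infimum need not be attained and may be 0; the extra \<open>e / 2\<close>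
    secures both membership in \<open>C\<close> and a positive divisor.\<close>
  define s where "s = minkowski_functional C v + e / 2"
  define t where "t = minkowski_functional C w + e / 2"
  have st: "0 < s" "0 < t"
    using e minkowski_functional_nonneg[of v] minkowski_functional_nonneg[of w]
    by (auto simp: s_def t_def)
  have "v /\<^sub>R s \<in> C" "w /\<^sub>R t \<in> C"
    using e by (auto simp: s_def t_def intro!: divideR_in_of_minkowski_functional_less)
  \<comment> \<open>The weights are chosen so that the divisors \<open>s\<close> and
    \<open>t\<close> cancel, leaving \<open>v + w\<close> over \<open>s + t\<close>.\<close>
  then have "(s / (s + t)) *\<^sub>R (v /\<^sub>R s) + (t / (s + t)) *\<^sub>R (w /\<^sub>R t) \<in> C"
    using st by (intro convexD[OF convex]) (auto simp: add_divide_distrib[symmetric])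
  moreover have "(s / (s + t)) *\<^sub>R (v /\<^sub>R s) + (t / (s + t)) *\<^sub>R (w /\<^sub>R t) = (v + w) /\<^sub>R (s + t)"
  proof -
    have "s / (s + t) * inverse s = inverse (s + t)" "t / (s + t) * inverse t = inverse (s + t)"
      using st by (auto simp: divide_simps)
    then show ?thesis by (simp only: scaleR_scaleR scaleR_add_right)
  qed
  ultimately have "minkowski_functional C (v + w) \<le> s + t"
    using st by (intro minkowski_functional_le) auto
  then show "minkowski_functional C (v + w)
      \<le> minkowski_functional C v + minkowski_functional C w + e"
    by (simp add: s_def t_def)
qed

lemma minkowski_functional_le_norm: "minkowski_functional C v \<le> norm v / \<rho>"
  by (rule dense_ge) (meson divideR_in_of_norm_less minkowski_functional_le)

text \<open>Subadditivity together with the bound \<open>norm v / \<rho>\<close> makes the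
  functional Lipschitz with constant \<open>1 / \<rho>\<close>.\<close>

lemma continuous_on_minkowski_functional: "continuous_on UNIV (minkowski_functional C)"
proof -
  have le: "minkowski_functional C v \<le> minkowski_functional C w + norm (v - w) / \<rho>" for v w
    using minkowski_functional_add_le[of w "v - w"] minkowski_functional_le_norm[of "v - w"]
    by simp
  have "\<bar>minkowski_functional C v - minkowski_functional C w\<bar> \<le> norm (v - w) / \<rho>" for v w
    using le[of v w] le[of w v] by (simp add: norm_minus_commute abs_le_iff)
  then have "(1 / \<rho>)-lipschitz_on UNIV (minkowski_functional C)"
    using pos by (intro lipschitz_onI) (auto simp: dist_norm)
  then show ?thesis by (rule lipschitz_on_continuous_on)
qed

lemma minkowski_functional_scaleR:
  assumes "0 < s"
  shows "minkowski_functional C (s *\<^sub>R v) = s * minkowski_functional C v"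
proof -
  have le: "minkowski_functional C (s *\<^sub>R v) \<le> s * minkowski_functional C v"
    if "0 < s" for s v
  proof -
    have "minkowski_functional C (s *\<^sub>R v) / s \<le> t" if "minkowski_functional C v < t" for t
    proof -
      have "0 < t" using that minkowski_functional_nonneg[of v] by simp
      then have "minkowski_functional C (s *\<^sub>R v) \<le> s * t"
        using \<open>0 < s\<close> divideR_in_of_minkowski_functional_less[OF that]
        by (intro minkowski_functional_le) (auto simp: field_simps)
      then show ?thesis using \<open>0 < s\<close> by (simp add: field_simps)
    qed
    then have "minkowski_functional C (s *\<^sub>R v) / s \<le> minkowski_functional C v"
      by (rule dense_ge)
    then show ?thesis using \<open>0 < s\<close> by (simp add: field_simps)
  qed
  show ?thesis
    \<comment> \<open>The reverse inequality is the same bound for the factor \<open>1 / s\<close>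
      at the vector \<open>s *\<^sub>R v\<close>.\<close>
    using le[of s v] le[of "1 / s" "s *\<^sub>R v"] assms by (simp add: field_simps)
qed

text \<open>A value below 1 leaves room to enlarge \<open>v\<close> within \<open>C\<close>, so
  \<open>v\<close> is interior. For value 1, letting \<open>t\<close> decrease to 1 gives
  \<open>v \<in> C\<close> by closedness, while an interior \<open>v\<close> could be enlarged
  slightly, forcing a value below 1.\<close>

lemma frontier_iff_minkowski_functional:
  assumes "closed C"
  shows "v \<in> frontier C \<longleftrightarrow> minkowski_functional C v = 1"
proof
  assume v: "v \<in> frontier C"
  then have "v \<in> C" "v \<notin> interior C"
    using assms by (auto simp: frontier_def)
  have "minkowski_functional C v \<le> 1"
    using \<open>v \<in> C\<close> by (intro minkowski_functional_le) auto
  moreover have "\<not> minkowski_functional C v < 1"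
  proof
    assume "minkowski_functional C v < 1"
    then obtain t where t: "minkowski_functional C v < t" "t < 1" using dense by blast
    then have "0 < t" using minkowski_functional_nonneg[of v] by simp
    \<comment> \<open>This combination is \<open>v\<close> itself, written as a point strictly
      between the interior point 0 and \<open>v /\<^sub>R t\<close>.\<close>
    have "(1 - t) *\<^sub>R 0 + (1 - (1 - t)) *\<^sub>R (v /\<^sub>R t) \<in> interior C"
      using t \<open>0 < t\<close> zero_in_interior divideR_in_of_minkowski_functional_less[OF t(1)]
      by (intro interior_scaleR_convex[OF convex]) auto
    then show False using \<open>0 < t\<close> \<open>v \<notin> interior C\<close> by simp
  qed
  ultimately show "minkowski_functional C v = 1" by simp
next
  assume v: "minkowski_functional C v = 1"
  have "((\<lambda>t. v /\<^sub>R t) \<longlongrightarrow> v /\<^sub>R 1) (at_right (1::real))"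
    by (intro tendsto_intros) auto
  moreover have "\<forall>\<^sub>F t in at_right (1::real). v /\<^sub>R t \<in> C"
    using v divideR_in_of_minkowski_functional_less
    by (auto simp: eventually_at_right_field intro!: exI[of _ 2])
  ultimately have "v \<in> C"
    using Lim_in_closed_set[OF assms] trivial_limit_at_right_real by (metis inverse_1 scaleR_one)
  moreover have "v \<notin> interior C"
  proof
    assume "v \<in> interior C"
    have "((\<lambda>t. v /\<^sub>R t) \<longlongrightarrow> v /\<^sub>R 1) (at_left (1::real))"
      by (intro tendsto_intros) auto
    then have "\<forall>\<^sub>F t in at_left (1::real). v /\<^sub>R t \<in> interior C"
      using \<open>v \<in> interior C\<close> by (intro topological_tendstoD) auto
    moreover have "\<forall>\<^sub>F t in at_left (1::real). t \<in> {0<..<1}"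
      by (rule eventually_at_leftI[of 0]) auto
    ultimately have "\<forall>\<^sub>F t in at_left (1::real). v /\<^sub>R t \<in> interior C \<and> t \<in> {0<..<1}"
      by (rule eventually_conj)
    then obtain t :: real where "v /\<^sub>R t \<in> interior C" "0 < t" "t < 1"
      using eventually_happens'[OF trivial_limit_at_left_real] by auto
    then show False
      using v minkowski_functional_le[of t v] interior_subset[of C] by auto
  qed
  ultimately show "v \<in> frontier C"
    using assms by (simp add: frontier_def)
qed

end

section \<open>Small connected pieces of the boundary by radial projection\<close>

lemma frontier_diff_iff:
  fixes K :: "'a::real_normed_vector set"
  shows "v \<in> frontier ((\<lambda>x. x - a) ` K) \<longleftrightarrow> v + a \<in> frontier K"
proof -
  have "frontier ((\<lambda>x. x - a) ` K) = (\<lambda>x. x - a) ` frontier K"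
    using frontier_translation[of "- a" K] by simp
  then show ?thesis by (auto simp: image_iff algebra_simps)
qed

text \<open>The radial projection from an interior point \<open>c\<close> is continuous near
  \<open>x\<close> and fixes boundary points, so the image of a small ball around \<open>x\<close>
  is connected, contains all nearby boundary points, and stays close to \<open>x\<close>.\<close>

lemma convex_body_frontier_locally_connected:
  fixes K :: "'a::real_normed_vector set"
  assumes K: "convex_body K" and x: "x \<in> frontier K" and \<epsilon>: "0 < \<epsilon>"
  obtains \<delta> S where "0 < \<delta>" "connected S" "frontier K \<inter> ball x \<delta> \<subseteq> S"
    "S \<subseteq> frontier K \<inter> ball x \<epsilon>"
proof -
  from K have "closed K" "convex K" by (auto simp: convex_body_def)
  obtain c \<rho> where c: "0 < \<rho>" "ball c \<rho> \<subseteq> K"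
    using K unfolding convex_body_def by (meson ex_in_conv mem_interior)
  define C where "C = (\<lambda>y. y - c) ` K"
  have conv: "convex C"
    using convex_translation[OF \<open>convex K\<close>, of "- c"] by (simp add: C_def)
  have cl: "closed C"
    using closed_translation[OF \<open>closed K\<close>, of "- c"] by (simp add: C_def)
  have ball: "ball 0 \<rho> \<subseteq> C"
  proof
    fix v :: 'a assume "v \<in> ball 0 \<rho>"
    then have "v + c \<in> K" using c(2) by (auto simp: dist_norm)
    then show "v \<in> C" unfolding C_def by force
  qed
  note fr = frontier_iff_minkowski_functional[OF conv c(1) ball cl]
  have fr': "y \<in> frontier K \<longleftrightarrow> minkowski_functional C (y - c) = 1" for y
    using fr[of "y - c"] frontier_diff_iff[of "y - c" c K] unfolding C_def[symmetric] by simp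
  define \<gamma> where "\<gamma> = (\<lambda>y. minkowski_functional C (y - c))"
  define \<pi> where "\<pi> = (\<lambda>y. c + (y - c) /\<^sub>R \<gamma> y)"
  have \<gamma>_cont: "continuous_on UNIV \<gamma>"
    unfolding \<gamma>_def
    by (rule continuous_on_compose2[OF continuous_on_minkowski_functional[OF conv c(1) ball]])
      (auto intro!: continuous_intros)
  \<comment> \<open>\<open>K\<close> may be unbounded, so \<open>\<gamma>\<close> can vanish away
    from \<open>c\<close>. Where it does, the inverse of 0 is 0 and \<open>\<pi>\<close> returns
    \<open>c\<close>; hence \<open>\<pi>\<close> is used on \<open>U\<close> only.\<close>
  define U where "U = {y. 0 < \<gamma> y}"
  have U: "open U"
    unfolding U_def by (rule open_Collect_less) (auto intro!: continuous_intros \<gamma>_cont)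
  have \<pi>_cont: "continuous_on U \<pi>"
    unfolding \<pi>_def
    by (intro continuous_intros continuous_on_subset[OF \<gamma>_cont]) (auto simp: U_def)
  have \<pi>_id: "\<pi> y = y" "y \<in> U" if "y \<in> frontier K" for y
    using that unfolding fr' by (simp_all add: \<pi>_def U_def \<gamma>_def)
  have \<pi>_fr: "\<pi> y \<in> frontier K" if "y \<in> U" for y
    using that minkowski_functional_scaleR[OF conv c(1) ball, of "inverse (\<gamma> y)" "y - c"]
    unfolding fr' by (simp add: \<pi>_def U_def \<gamma>_def)
  have "isCont \<pi> x"
    using \<pi>_cont U \<pi>_id(2)[OF x] by (simp add: continuous_on_eq_continuous_at)
  then have "\<forall>\<^sub>F y in at x. \<pi> y \<in> ball (\<pi> x) \<epsilon>"
    using \<epsilon> unfolding isCont_def by (intro topological_tendstoD) auto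
  then obtain d1 where d1: "0 < d1" "\<And>y. y \<noteq> x \<Longrightarrow> dist y x < d1 \<Longrightarrow> \<pi> y \<in> ball x \<epsilon>"
    unfolding eventually_at \<pi>_id(1)[OF x] by blast
  obtain d2 where d2: "0 < d2" "ball x d2 \<subseteq> U"
    using U \<pi>_id(2)[OF x] open_contains_ball by blast
  define \<delta> where "\<delta> = min d1 d2"
  show thesis
  proof
    show "0 < \<delta>" using d1 d2 by (simp add: \<delta>_def)
    show "connected (\<pi> ` ball x \<delta>)"
      using d2 by (intro connected_continuous_image continuous_on_subset[OF \<pi>_cont] convex_connected)
        (auto simp: \<delta>_def)
    show "frontier K \<inter> ball x \<delta> \<subseteq> \<pi> ` ball x \<delta>"
      using \<pi>_id(1) by force
    show "\<pi> ` ball x \<delta> \<subseteq> frontier K \<inter> ball x \<epsilon>"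
    proof clarify
      fix y assume y: "y \<in> ball x \<delta>"
      have "\<pi> y \<in> frontier K" using y d2 by (intro \<pi>_fr) (auto simp: \<delta>_def)
      moreover have "\<pi> y \<in> ball x \<epsilon>"
      proof (cases "y = x")
        case True
        then show ?thesis using \<pi>_id(1)[OF x] \<epsilon> by simp
      next
        case False
        then show ?thesis using y d1(2)[of y] by (auto simp: \<delta>_def dist_commute)
      qed
      ultimately show "\<pi> y \<in> frontier K \<inter> ball x \<epsilon>" by blast
    qed
  qed
qed

section \<open>From a symmetric boundary to a supporting hyperplane\<close>

lemma flat_functional_of_symmetric_frontier:
  fixes C :: "'a::real_normed_vector set"
  assumes clo: "closed C" and conv: "convex C" and u: "u \<in> interior C"
    and zero: "0 \<in> frontier C" and \<epsilon>: "0 < \<epsilon>"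
    and sym: "\<And>r. r \<in> frontier C \<inter> ball 0 \<epsilon> \<Longrightarrow> - r \<in> C"
  obtains f :: "'a \<Rightarrow> real" where "bounded_linear f" "f u = - 1" "\<And>x. x \<in> C \<Longrightarrow> f x \<le> 0"
    "\<And>x. x \<in> frontier C \<inter> ball 0 \<epsilon> \<Longrightarrow> f x = 0"
proof -
  define D where "D = frontier C \<inter> ball 0 \<epsilon>"
  have frontier: "v \<in> frontier C \<longleftrightarrow> v \<in> C \<and> v \<notin> interior C" for v
    using clo by (simp add: frontier_def)
  have zero': "0 \<in> C" "0 \<notin> interior C" using zero frontier by auto
  have cone: "s *\<^sub>R v \<in> interior C" if "v \<in> interior C" "0 < s" "s \<le> 1" for v s
    using interior_scaleR_convex[OF conv that(1) zero'(1) that(2,3)] by simp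
  \<comment> \<open>Otherwise 0, the midpoint of \<open>v\<close> and \<open>- v\<close>, would be
    interior.\<close>
  have opp: "- v \<notin> C" if "v \<in> interior C" for v
    using interior_scaleR_convex[OF conv that, of "- v" "1/2"] zero'(2) by auto
  have D_neg: "- d \<in> D" if "d \<in> D" for d
    using sym[of d] opp[of "- d"] that frontier[of d] frontier[of "- d"] by (auto simp: D_def)
  have D_mid: "(1/2) *\<^sub>R (p + q) \<in> D" if "p \<in> D" "q \<in> D" for p q
  proof -
    have in_C: "(1/2) *\<^sub>R (p + q) \<in> C" if "p \<in> D" "q \<in> D" for p q
      using that convexD[OF conv, of p q "1/2" "1/2"] frontier
      by (auto simp: D_def scaleR_add_right)
    \<comment> \<open>The negated midpoint also lies in \<open>C\<close>, so \<open>opp\<close>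
      keeps the midpoint out of the interior.\<close>
    have "(1/2) *\<^sub>R (- p + - q) \<in> C" by (intro in_C D_neg that)
    then have "- ((1/2) *\<^sub>R (p + q)) \<in> C" by (simp add: algebra_simps)
    then have "(1/2) *\<^sub>R (p + q) \<notin> interior C" using opp by blast
    moreover have "norm (p + q) < 2 * \<epsilon>"
      using norm_triangle_ineq[of p q] that by (auto simp: D_def)
    ultimately show ?thesis using in_C[OF that] frontier by (auto simp: D_def)
  qed
  have D_scale: "s *\<^sub>R d \<in> D" if d: "d \<in> D" and s: "0 < s" "s \<le> 1" for s d
  proof -
    have in_C: "s *\<^sub>R d \<in> C" if "d \<in> D" for d
      using that convexD[OF conv, of d 0 s "1 - s"] frontier zero' s by (auto simp: D_def)
    have "- (s *\<^sub>R d) \<in> C" using in_C[OF D_neg[OF d]] by simp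
    then have "s *\<^sub>R d \<notin> interior C" using opp by blast
    moreover have "s * norm d \<le> 1 * norm d" using s by (intro mult_right_mono) auto
    ultimately show ?thesis using in_C[OF d] frontier d s by (auto simp: D_def)
  qed
  \<comment> \<open>\<open>H\<close> is the cone generated by \<open>D\<close>. Symmetry and
    midpoint convexity make it a linear subspace, and it will be the kernel of
    \<open>f\<close>.\<close>
  define H where "H = {h. \<exists>s>0. s *\<^sub>R h \<in> D}"
  have H_D: "d \<in> H" if "d \<in> D" for d
    using that by (auto simp: H_def intro!: exI[of _ 1])
  have H_scale_pos: "t *\<^sub>R h \<in> H" if "h \<in> H" "0 < t" for t h
  proof -
    obtain s where "0 < s" "s *\<^sub>R h \<in> D" using \<open>h \<in> H\<close> by (auto simp: H_def)
    then show ?thesis using \<open>0 < t\<close> unfolding H_def by (auto intro!: exI[of _ "s / t"])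
  qed
  have H_neg: "- h \<in> H" if "h \<in> H" for h
    using that D_neg unfolding H_def by force
  have "0 \<in> D" using zero \<epsilon> by (simp add: D_def)
  have H_scale: "t *\<^sub>R h \<in> H" if "h \<in> H" for t h
  proof -
    consider "t = 0" | "0 < t" | "t < 0" by linarith
    then show ?thesis
    proof cases
      case 1
      then show ?thesis using H_D[OF \<open>0 \<in> D\<close>] by simp
    next
      case 2
      then show ?thesis using H_scale_pos that by blast
    next
      case 3
      then show ?thesis using H_scale_pos[of "- h" "- t"] H_neg that by simp
    qed
  qed
  have H_add: "g + h \<in> H" if gh: "g \<in> H" "h \<in> H" for g h
  proof -
    obtain s t where st: "0 < s" "s *\<^sub>R g \<in> D" "0 < t" "t *\<^sub>R h \<in> D"
      using gh by (auto simp: H_def)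
    \<comment> \<open>A common factor brings both vectors into \<open>D\<close>, where midpoints are
      available.\<close>
    define m where "m = min s t"
    have "0 < m" using st by (simp add: m_def)
    have "(m / s) *\<^sub>R s *\<^sub>R g \<in> D" "(m / t) *\<^sub>R t *\<^sub>R h \<in> D"
      using st by (auto intro!: D_scale[of "s *\<^sub>R g"] D_scale[of "t *\<^sub>R h"] simp del: scaleR_scaleR simp: m_def)
    then have "(1/2) *\<^sub>R (m *\<^sub>R g + m *\<^sub>R h) \<in> D"
      using st by (intro D_mid) auto
    then have "(m / 2) *\<^sub>R (g + h) \<in> D" by (simp add: scaleR_add_right)
    then show ?thesis using \<open>0 < m\<close> unfolding H_def by (auto intro!: exI[of _ "m / 2"])
  qed
  have H_int: "h \<notin> interior C" if h: "h \<in> H" for h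
  proof
    assume int: "h \<in> interior C"
    obtain s where s: "0 < s" "s *\<^sub>R h \<in> D" using h by (auto simp: H_def)
    \<comment> \<open>Shrinking by at most \<open>s\<close> puts \<open>h\<close> into
      \<open>D\<close>, and by at most 1 keeps it interior, which is contradictory.\<close>
    define m where "m = min 1 s"
    have m: "0 < m" "m \<le> 1" "m \<le> s" using s by (auto simp: m_def)
    then have "(m / s) *\<^sub>R s *\<^sub>R h \<in> D" using s by (intro D_scale[OF s(2)]) auto
    then have "m *\<^sub>R h \<in> D" using s by simp
    then show False using cone[OF int m(1,2)] frontier by (auto simp: D_def)
  qed
  \<comment> \<open>After \<open>x\<close> is scaled down to a tiny \<open>s *\<^sub>R x\<close>,
    the segment in direction \<open>u\<close> through it runs from outside \<open>C\<close> to its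
    interior and so meets the boundary within the ball, hence \<open>D\<close>. Dividing by
    \<open>s\<close> returns to \<open>x\<close>.\<close>
  have ex: "\<exists>t. x + t *\<^sub>R u \<in> H" for x
  proof -
    have n: "0 < norm u + 1" by (simp add: add_nonneg_pos)
    \<comment> \<open>The bound 1 keeps \<open>\<tau> *\<^sub>R u\<close> interior; the other gives
      it norm below \<open>\<epsilon> / 2\<close>, leaving the other half for
      \<open>s *\<^sub>R x\<close>. Adding 1 to \<open>norm u\<close> avoids division by 0.\<close>
    define \<tau> where "\<tau> = min 1 (\<epsilon> / 2 / (norm u + 1))"
    have \<tau>: "0 < \<tau>" "\<tau> \<le> 1" "\<tau> \<le> \<epsilon> / 2 / (norm u + 1)"
      using \<epsilon> n by (simp_all add: \<tau>_def)
    from \<tau>(3) have "\<tau> * (norm u + 1) \<le> \<epsilon> / 2" by (subst (asm) pos_le_divide_eq[OF n])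
    then have \<tau>u: "\<tau> * norm u < \<epsilon> / 2" using \<tau>(1) by (simp only: distrib_left mult_1_right)
    have int: "\<tau> *\<^sub>R u \<in> interior C" using cone[OF u] \<tau> by simp
    then have out: "- (\<tau> *\<^sub>R u) \<in> - C" using opp by simp
    have "((\<lambda>s. s *\<^sub>R x + \<tau> *\<^sub>R u) \<longlongrightarrow> 0 *\<^sub>R x + \<tau> *\<^sub>R u) (at_right (0::real))"
      by (intro tendsto_intros)
    then have e1: "\<forall>\<^sub>F s in at_right (0::real). s *\<^sub>R x + \<tau> *\<^sub>R u \<in> interior C"
      using int by (intro topological_tendstoD) auto
    have "((\<lambda>s. s *\<^sub>R x + - (\<tau> *\<^sub>R u)) \<longlongrightarrow> 0 *\<^sub>R x + - (\<tau> *\<^sub>R u)) (at_right (0::real))"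
      by (intro tendsto_intros)
    then have e2: "\<forall>\<^sub>F s in at_right (0::real). s *\<^sub>R x + - (\<tau> *\<^sub>R u) \<in> - C"
      using out clo by (intro topological_tendstoD) auto
    have "((\<lambda>s. s *\<^sub>R x) \<longlongrightarrow> 0 *\<^sub>R x) (at_right (0::real))"
      by (intro tendsto_intros)
    then have e3: "\<forall>\<^sub>F s in at_right (0::real). s *\<^sub>R x \<in> ball 0 (\<epsilon> / 2)"
      using \<epsilon> by (intro topological_tendstoD) auto
    have e4: "\<forall>\<^sub>F s in at_right (0::real). 0 < s"
      by (rule eventually_at_right_less)
    from e1 e2 e3 e4 have "\<forall>\<^sub>F s in at_right (0::real). s *\<^sub>R x + \<tau> *\<^sub>R u \<in> interior C \<and>
        s *\<^sub>R x + - (\<tau> *\<^sub>R u) \<in> - C \<and> s *\<^sub>R x \<in> ball 0 (\<epsilon> / 2) \<and> 0 < s"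
      by eventually_elim auto
    then obtain s :: real where s: "s *\<^sub>R x + \<tau> *\<^sub>R u \<in> interior C"
        "s *\<^sub>R x + - (\<tau> *\<^sub>R u) \<notin> C" "s *\<^sub>R x \<in> ball 0 (\<epsilon> / 2)" "0 < s"
      using eventually_happens'[OF trivial_limit_at_right_real] by blast
    define L where "L = (\<lambda>t. s *\<^sub>R x + t *\<^sub>R u) ` {- \<tau>..\<tau>}"
    have "connected L"
      unfolding L_def by (intro connected_continuous_image continuous_intros) auto
    moreover have "L \<inter> C \<noteq> {}" "L - C \<noteq> {}"
    proof -
      have "s *\<^sub>R x + \<tau> *\<^sub>R u \<in> L" using \<tau> unfolding L_def by (intro imageI) auto
      then show "L \<inter> C \<noteq> {}" using s(1) interior_subset by blast
      have "s *\<^sub>R x + (- \<tau>) *\<^sub>R u \<in> L" using \<tau> unfolding L_def by (intro imageI) auto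
      then show "L - C \<noteq> {}" using s(2) by auto
    qed
    ultimately obtain t where t: "t \<in> {- \<tau>..\<tau>}" "s *\<^sub>R x + t *\<^sub>R u \<in> frontier C"
      using connected_Int_frontier[of L C] unfolding L_def by blast
    have "norm (s *\<^sub>R x + t *\<^sub>R u) \<le> norm (s *\<^sub>R x) + \<bar>t\<bar> * norm u"
      using norm_triangle_ineq[of "s *\<^sub>R x" "t *\<^sub>R u"] by simp
    also have "\<bar>t\<bar> * norm u \<le> \<tau> * norm u" using t by (intro mult_right_mono) auto
    finally have "s *\<^sub>R x + t *\<^sub>R u \<in> D" using s(3) t \<tau>u by (simp add: D_def)
    then have "(1 / s) *\<^sub>R (s *\<^sub>R x + t *\<^sub>R u) \<in> H" by (intro H_scale H_D)
    then have "x + (t / s) *\<^sub>R u \<in> H" using s(4) by (simp add: scaleR_add_right)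
    then show ?thesis by blast
  qed
  \<comment> \<open>Two different coefficients would put the interior point \<open>u\<close> into
    the subspace \<open>H\<close>.\<close>
  have uniq: "a = b" if "x + a *\<^sub>R u \<in> H" "x + b *\<^sub>R u \<in> H" for x a b
  proof (rule ccontr)
    assume "a \<noteq> b"
    have "(x + a *\<^sub>R u) + - (x + b *\<^sub>R u) \<in> H" by (intro H_add H_neg that)
    then have "(a - b) *\<^sub>R u \<in> H" by (simp add: algebra_simps)
    then have "(1 / (a - b)) *\<^sub>R (a - b) *\<^sub>R u \<in> H" by (rule H_scale)
    then show False using H_int[of u] u \<open>a \<noteq> b\<close> by simp
  qed
  \<comment> \<open>\<open>f\<close> is the projection along \<open>u\<close> onto \<open>H\<close>
    read as a coefficient; uniqueness of the coefficient yields linearity.\<close>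
  obtain f where f: "\<And>x. x + f x *\<^sub>R u \<in> H" using ex by metis
  have f_eq: "f x = a" if "x + a *\<^sub>R u \<in> H" for x a
    using uniq f that by blast
  have f_add: "f (x + y) = f x + f y" for x y
    using H_add[OF f[of x] f[of y]] by (intro f_eq) (simp add: algebra_simps)
  have f_scale: "f (r *\<^sub>R x) = r * f x" for r x
    using H_scale[OF f[of x], of r] by (intro f_eq) (simp add: algebra_simps)
  have f_u: "f u = - 1" using H_D[OF \<open>0 \<in> D\<close>] by (intro f_eq) simp
  have f_C: "f x \<le> 0" if x: "x \<in> C" for x
  proof (rule ccontr)
    assume "\<not> f x \<le> 0"
    then have t: "0 < f x" by simp
    \<comment> \<open>The weights make this point a multiple of \<open>x + f x *\<^sub>R u\<close>,
      hence an element of \<open>H\<close> in the interior.\<close>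
    have "(f x / (1 + f x)) *\<^sub>R u + (1 - f x / (1 + f x)) *\<^sub>R x \<in> interior C"
      using t by (intro interior_scaleR_convex[OF conv u x]) auto
    moreover have "1 - f x / (1 + f x) = 1 / (1 + f x)" using t by (simp add: field_simps)
    ultimately have "(1 / (1 + f x)) *\<^sub>R (x + f x *\<^sub>R u) \<in> interior C"
      by (simp add: algebra_simps)
    then show False using H_int H_scale[OF f] by blast
  qed
  obtain \<rho> where \<rho>: "0 < \<rho>" "cball u \<rho> \<subseteq> C"
    using u by (auto simp: mem_interior_cball)
  have f_le: "f x \<le> norm x * (1 / \<rho>)" for x
  proof (cases "x = 0")
    case True
    then show ?thesis using f_scale[of 0 0] by simp
  next
    case False
    \<comment> \<open>This point of \<open>C\<close> has \<open>f\<close>-value at most 0; since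
      \<open>f u = - 1\<close>, that bounds \<open>f x\<close>.\<close>
    have "u + (\<rho> / norm x) *\<^sub>R x \<in> cball u \<rho>" using \<rho> False by (simp add: dist_norm)
    then have "f (u + (\<rho> / norm x) *\<^sub>R x) \<le> 0" using \<rho> f_C by blast
    then have "\<rho> / norm x * f x \<le> 1" by (simp add: f_add f_scale f_u)
    then show ?thesis using False \<rho> by (simp add: field_simps)
  qed
  have "norm (f x) \<le> norm x * (1 / \<rho>)" for x
    using f_le[of x] f_le[of "- x"] f_scale[of "- 1" x] by (simp add: abs_le_iff)
  then have "bounded_linear f"
    by (intro bounded_linear_intro[where K = "1 / \<rho>"]) (auto simp: f_add f_scale)
  moreover have "f x = 0" if "x \<in> frontier C \<inter> ball 0 \<epsilon>" for x
    using H_D[of x] that by (intro f_eq) (simp add: D_def)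
  ultimately show thesis using that f_u f_C by blast
qed

text \<open>Translating \<open>x\<close> to the origin turns \<open>2 *\<^sub>R x - r\<close> into
  \<open>- r\<close>. The resulting functional is nonzero, having value -1 at \<open>c - x\<close>,
  and is normalised to lie in the dual unit sphere.\<close>

lemma flattening_point_of_symmetric_frontier:
  fixes K :: "'a::real_normed_vector set"
  assumes K: "convex_body K" and x: "x \<in> frontier K" and \<epsilon>: "0 < \<epsilon>"
    and sym: "\<And>r. r \<in> frontier K \<inter> ball x \<epsilon> \<Longrightarrow> 2 *\<^sub>R x - r \<in> K"
  shows "flattening_point K x"
proof -
  from K have clo: "closed K" and conv: "convex K" by (auto simp: convex_body_def)
  obtain c where c: "c \<in> interior K" using K by (auto simp: convex_body_def)
  define C where "C = (\<lambda>y. y - x) ` K"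
  have C_iff: "v \<in> C \<longleftrightarrow> v + x \<in> K" for v by (force simp: C_def)
  have fr: "v \<in> frontier C \<longleftrightarrow> v + x \<in> frontier K" for v
    by (simp add: C_def frontier_diff_iff)
  have in_ball: "v \<in> ball 0 \<epsilon> \<longleftrightarrow> v + x \<in> ball x \<epsilon>" for v by (simp add: dist_norm)
  obtain f :: "'a \<Rightarrow> real" where f: "bounded_linear f" "f (c - x) = - 1"
      "\<And>v. v \<in> C \<Longrightarrow> f v \<le> 0" "\<And>v. v \<in> frontier C \<inter> ball 0 \<epsilon> \<Longrightarrow> f v = 0"
  proof (rule flat_functional_of_symmetric_frontier[of C "c - x" \<epsilon>])
    show "closed C" using closed_translation[OF clo, of "- x"] by (simp add: C_def)
    show "convex C" using convex_translation[OF conv, of "- x"] by (simp add: C_def)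
    have "interior C = (\<lambda>y. y - x) ` interior K"
      using interior_translation[of "- x" K] by (simp add: C_def)
    then show "c - x \<in> interior C" using c by blast
    show "0 \<in> frontier C" using x by (simp add: fr)
    show "- r \<in> C" if "r \<in> frontier C \<inter> ball 0 \<epsilon>" for r
      using that sym[of "r + x"] unfolding Int_iff fr in_ball C_iff
      by (simp add: scaleR_2)
  qed (use \<epsilon> in auto)
  interpret bounded_linear f by fact
  define F where "F = Blinfun f"
  have F: "blinfun_apply F = f" unfolding F_def by (rule bounded_linear_Blinfun_apply) fact
  have "F \<noteq> 0" using f(2) F by auto
  define G where "G = F /\<^sub>R norm F"
  have G: "blinfun_apply G v = f v / norm F" for v
    by (simp add: G_def scaleR_blinfun.rep_eq F divide_inverse mult.commute)
  have "norm G = 1" using \<open>F \<noteq> 0\<close> by (simp add: G_def)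
  have "f y \<le> f x" if "y \<in> K" for y
    using f(3)[of "y - x"] that by (simp add: C_iff diff)
  then have "G \<in> unit_support_functionals K x"
    using \<open>norm G = 1\<close> by (auto simp: unit_support_functionals_def G divide_right_mono)
  moreover have "blinfun_apply G y = blinfun_apply G x" if "y \<in> frontier K \<inter> ball x \<epsilon>" for y
    using f(4)[of "y - x"] that by (simp add: fr dist_norm norm_minus_commute diff G)
  ultimately show ?thesis
    unfolding flattening_point_def using x \<epsilon> by blast
qed

section \<open>Sums of boundary points near a non-flattening point\<close>

lemma interior_frontier_sum_nonempty:
  fixes K :: "'a::real_normed_vector set"
  assumes K: "convex_body K" and x: "x \<in> frontier K" and \<epsilon>: "0 < \<epsilon>"
    and nonflat: "\<not> flattening_point K x"
  shows "interior ((frontier K \<inter> ball x \<epsilon>) + (frontier K \<inter> ball x \<epsilon>)) \<noteq> {}"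
proof -
  from K have clo: "closed K" and conv: "convex K" by (auto simp: convex_body_def)
  obtain c where c: "c \<in> interior K" using K by (auto simp: convex_body_def)
  have "x \<in> K" using x clo by (simp add: frontier_def)
  obtain \<delta> S where S: "0 < \<delta>" "connected S" "frontier K \<inter> ball x \<delta> \<subseteq> S"
      "S \<subseteq> frontier K \<inter> ball x (\<epsilon> / 2)"
    using convex_body_frontier_locally_connected[OF K x, of "\<epsilon> / 2"] \<epsilon> by auto
  obtain r where r: "r \<in> frontier K \<inter> ball x \<delta>" "2 *\<^sub>R x - r \<notin> K"
    using flattening_point_of_symmetric_frontier[OF K x S(1)] nonflat by blast
  \<comment> \<open>For \<open>y\<close> in \<open>W\<close>, the set of all \<open>y - p\<close>
    with \<open>p\<close> in \<open>S\<close> meets both \<open>K\<close> and its complement, via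
    \<open>p = x\<close> and \<open>p = r\<close>. The radii \<open>\<epsilon> / 2\<close> of
    \<open>W\<close> and \<open>S\<close> add up to the \<open>\<epsilon>\<close> allowed for
    \<open>y - p\<close>.\<close>
  define W where "W = (\<lambda>y. y - x) -` interior K \<inter> (\<lambda>y. y - r) -` (- K) \<inter> ball (2 *\<^sub>R x) (\<epsilon> / 2)"
  have "open W"
    unfolding W_def using clo
    by (intro open_Int open_vimage continuous_intros) auto
  have "W \<noteq> {}"
  proof -
    \<comment> \<open>Moving from \<open>2 *\<^sub>R x\<close> slightly in direction
      \<open>c - x\<close> makes \<open>y - x\<close> interior, while \<open>y - r\<close> stays in
      the open complement of \<open>K\<close>.\<close>
    have "((\<lambda>t. (2 *\<^sub>R x + t *\<^sub>R (c - x)) - r) \<longlongrightarrow> (2 *\<^sub>R x + 0 *\<^sub>R (c - x)) - r) (at_right (0::real))"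
      by (intro tendsto_intros)
    then have e1: "\<forall>\<^sub>F t in at_right (0::real). (2 *\<^sub>R x + t *\<^sub>R (c - x)) - r \<in> - K"
      using clo r by (intro topological_tendstoD) auto
    have "((\<lambda>t. 2 *\<^sub>R x + t *\<^sub>R (c - x)) \<longlongrightarrow> 2 *\<^sub>R x + 0 *\<^sub>R (c - x)) (at_right (0::real))"
      by (intro tendsto_intros)
    then have e2: "\<forall>\<^sub>F t in at_right (0::real). 2 *\<^sub>R x + t *\<^sub>R (c - x) \<in> ball (2 *\<^sub>R x) (\<epsilon> / 2)"
      using \<epsilon> by (intro topological_tendstoD) auto
    have e3: "\<forall>\<^sub>F t in at_right (0::real). t \<in> {0<..<1}"
      by (rule eventually_at_rightI[of 0 1]) auto
    from e1 e2 e3 have "\<forall>\<^sub>F t in at_right (0::real). 2 *\<^sub>R x + t *\<^sub>R (c - x) \<in> W"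
    proof eventually_elim
      case (elim t)
      have "t *\<^sub>R c + (1 - t) *\<^sub>R x \<in> interior K"
        using elim by (intro interior_scaleR_convex[OF conv c \<open>x \<in> K\<close>]) auto
      moreover have "(2 *\<^sub>R x + t *\<^sub>R (c - x)) - x = t *\<^sub>R c + (1 - t) *\<^sub>R x"
        by (simp add: algebra_simps scaleR_2)
      ultimately show ?case using elim by (simp add: W_def)
    qed
    then show ?thesis
      using eventually_happens'[OF trivial_limit_at_right_real] by blast
  qed
  moreover have "W \<subseteq> (frontier K \<inter> ball x \<epsilon>) + (frontier K \<inter> ball x \<epsilon>)"
  proof
    fix y assume y: "y \<in> W"
    have "x \<in> S" "r \<in> S" using S x r by auto
    have "connected ((\<lambda>p. y - p) ` S)"
      by (intro connected_continuous_image continuous_intros S)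
    moreover have "(\<lambda>p. y - p) ` S \<inter> K \<noteq> {}"
      using \<open>x \<in> S\<close> y interior_subset by (auto simp: W_def)
    moreover have "(\<lambda>p. y - p) ` S - K \<noteq> {}"
      using \<open>r \<in> S\<close> y by (auto simp: W_def)
    ultimately obtain p where p: "p \<in> S" "y - p \<in> frontier K"
      using connected_Int_frontier[of "(\<lambda>p. y - p) ` S" K] by blast
    have "p \<in> frontier K" "dist x p < \<epsilon> / 2" using p S by auto
    moreover have "dist (2 *\<^sub>R x) y < \<epsilon> / 2" using y by (simp add: W_def)
    moreover have "dist x (y - p) \<le> dist (2 *\<^sub>R x) y + dist x p"
      \<comment> \<open>The difference of these two vectors is \<open>x - (y - p)\<close>.\<close>
      using norm_triangle_ineq4[of "2 *\<^sub>R x - y" "x - p"]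
      by (simp add: dist_norm scaleR_2 algebra_simps)
    ultimately have "y - p \<in> frontier K \<inter> ball x \<epsilon>" "p \<in> frontier K \<inter> ball x \<epsilon>"
      using p(2) \<epsilon> by auto
    then have "p + (y - p) \<in> (frontier K \<inter> ball x \<epsilon>) + (frontier K \<inter> ball x \<epsilon>)"
      by (intro set_plus_intro)
    then show "y \<in> (frontier K \<inter> ball x \<epsilon>) + (frontier K \<inter> ball x \<epsilon>)" by simp
  qed
  ultimately show ?thesis
    using \<open>open W\<close> interior_maximal by blast
qed

section \<open>Flattening points and the equivalence\<close>

lemma interior_blinfun_level_set:
  fixes f :: "'a::real_normed_vector \<Rightarrow>\<^sub>L real"
  assumes "f \<noteq> 0"
  shows "interior {x. blinfun_apply f x = b} = {}"
proof (rule ccontr)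
  assume "interior {x. blinfun_apply f x = b} \<noteq> {}"
  then obtain x where x: "x \<in> interior {x. blinfun_apply f x = b}" by blast
  \<comment> \<open>Any small step in direction \<open>v\<close> changes the value of
    \<open>f\<close>, so it leaves the level set.\<close>
  obtain v where v: "blinfun_apply f v \<noteq> 0"
    using assms by (metis blinfun_eqI zero_blinfun.rep_eq)
  have "((\<lambda>t. x + t *\<^sub>R v) \<longlongrightarrow> x + 0 *\<^sub>R v) (at_right (0::real))"
    by (intro tendsto_intros)
  then have "\<forall>\<^sub>F t in at_right (0::real). x + t *\<^sub>R v \<in> interior {x. blinfun_apply f x = b}"
    using x by (intro topological_tendstoD) auto
  with eventually_at_right_less[of 0]
  have "\<forall>\<^sub>F t in at_right (0::real). 0 < t \<and> x + t *\<^sub>R v \<in> interior {x. blinfun_apply f x = b}"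
    by eventually_elim auto
  then obtain t :: real where t: "0 < t" "x + t *\<^sub>R v \<in> interior {x. blinfun_apply f x = b}"
    using eventually_happens'[OF trivial_limit_at_right_real] by blast
  have "blinfun_apply f (x + t *\<^sub>R v) = b" "blinfun_apply f x = b"
    using t(2) x interior_subset by blast+
  then show False using t(1) v by (simp add: blinfun.add_right blinfun.scaleR_right)
qed

theorem theorem2:
  fixes K :: "'a::real_normed_vector set" and x\<^sub>0 :: 'a
  assumes "convex_body K" and "x\<^sub>0 \<in> frontier K"
  shows "\<not> flattening_point K x\<^sub>0 \<longleftrightarrow>
    (\<forall>\<delta>>0. \<exists>\<epsilon>::real. 0 < \<epsilon> \<and> \<epsilon> < \<delta> \<and>
       interior ((frontier K \<inter> ball x\<^sub>0 \<epsilon>) + (frontier K \<inter> ball x\<^sub>0 \<epsilon>)) \<noteq> {})"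
proof
  assume nonflat: "\<not> flattening_point K x\<^sub>0"
  show "\<forall>\<delta>>0. \<exists>\<epsilon>::real. 0 < \<epsilon> \<and> \<epsilon> < \<delta> \<and>
       interior ((frontier K \<inter> ball x\<^sub>0 \<epsilon>) + (frontier K \<inter> ball x\<^sub>0 \<epsilon>)) \<noteq> {}"
  proof (intro allI impI)
    fix \<delta> :: real assume "0 < \<delta>"
    then show "\<exists>\<epsilon>::real. 0 < \<epsilon> \<and> \<epsilon> < \<delta> \<and>
       interior ((frontier K \<inter> ball x\<^sub>0 \<epsilon>) + (frontier K \<inter> ball x\<^sub>0 \<epsilon>)) \<noteq> {}"
      using interior_frontier_sum_nonempty[OF assms _ nonflat, of "\<delta> / 2"]
      by (intro exI[of _ "\<delta> / 2"]) auto
  qed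
next
  assume small: "\<forall>\<delta>>0. \<exists>\<epsilon>::real. 0 < \<epsilon> \<and> \<epsilon> < \<delta> \<and>
       interior ((frontier K \<inter> ball x\<^sub>0 \<epsilon>) + (frontier K \<inter> ball x\<^sub>0 \<epsilon>)) \<noteq> {}"
  show "\<not> flattening_point K x\<^sub>0"
  proof
    assume "flattening_point K x\<^sub>0"
    then obtain \<delta> f c where \<delta>: "0 < \<delta>" and f: "f \<in> unit_support_functionals K x\<^sub>0"
      and c: "\<And>x. x \<in> frontier K \<inter> ball x\<^sub>0 \<delta> \<Longrightarrow> blinfun_apply f x = c"
      unfolding flattening_point_def by blast
    obtain \<epsilon> where \<epsilon>: "\<epsilon> < \<delta>"
      and ne: "interior ((frontier K \<inter> ball x\<^sub>0 \<epsilon>) + (frontier K \<inter> ball x\<^sub>0 \<epsilon>)) \<noteq> {}"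
      using small \<delta> by blast
    \<comment> \<open>Near a flattening point both summands have \<open>f\<close>-value
      \<open>c\<close>, so the whole sum lies in one level set of a nonzero functional.\<close>
    have "(frontier K \<inter> ball x\<^sub>0 \<epsilon>) + (frontier K \<inter> ball x\<^sub>0 \<epsilon>) \<subseteq> {x. blinfun_apply f x = c + c}"
      using c \<epsilon> by (auto elim!: set_plus_elim simp: blinfun.add_right)
    moreover have "f \<noteq> 0" using f by (auto simp: unit_support_functionals_def)
    ultimately show False
      using ne interior_mono interior_blinfun_level_set by blast
  qed
qed

end
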